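(* There exist a group $G$, finite generating sets $\mathcal S\subset\tilde{\mathcal S}$ of $G$, and an infinite geodesic $\gamma$ in $X:=\mathrm{Cay}(G,\mathcal S)$ labelled by the powers of a single generator, with the following properties: - $\gamma$ is not strongly contracting in $X$; - the image $\tilde\gamma$ of $\gamma$ in $\tilde X:=\mathrm{Cay}(G,\tilde{\mathcal S})$, obtained from the inclusion $\mathcal S\subset\tilde{\mathcal S}$, is an infinite strongly contracting geodesic in $\tilde X$.
   Context: Cayley graphs carry the graph metric. For a closed subspace $Y$ of a geodesic metric space, closest point projection is $\pi(x)=\{y\in Y:d(x,y)=d(x,Y)\}$. $Y$ is strongly contracting if there is a constant $C$ such that, for all $x,x'$, $d(x,x')\le d(x,Y)$ implies $\mathrm{diam}(\pi(x)\cup\pi(x'))\le C$. *)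

theory Defs
  imports "HOL-Algebra.Generated_Groups" Complex_Main
begin

definition word_len :: "('a, 'b) monoid_scheme \<Rightarrow> 'a set \<Rightarrow> 'a \<Rightarrow> nat" where
  "word_len G S g = (LEAST n. \<exists>ws. length ws = n \<and> set ws \<subseteq> S \<union> m_inv G ` S
        \<and> foldr (\<lambda>x y. x \<otimes>\<^bsub>G\<^esub> y) ws \<one>\<^bsub>G\<^esub> = g)"

definition word_dist :: "('a, 'b) monoid_scheme \<Rightarrow> 'a set \<Rightarrow> 'a \<Rightarrow> 'a \<Rightarrow> nat" where
  "word_dist G S g h = word_len G S (inv\<^bsub>G\<^esub> g \<otimes>\<^bsub>G\<^esub> h)"

text \<open>Points of the geometric realisation of Cay(G,S) (unit-length edges):
  (g, s, t) is the point at distance t from g on the edge from g to g s labelled s.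
  Vertices have several representatives (t = 0 or t = 1); the distance below is a
  pseudometric identifying them.\<close>
definition cay_points :: "('a, 'b) monoid_scheme \<Rightarrow> 'a set \<Rightarrow> ('a \<times> 'a \<times> real) set" where
  "cay_points G S = {(g, s, t). g \<in> carrier G \<and> s \<in> S \<and> 0 \<le> t \<and> t \<le> 1}"

text \<open>Path metric of the metric graph Cay(G,S): a shortest path either stays inside one
  edge, or leaves the edge of p through one of its endpoints and enters the edge of q
  through one of its endpoints.\<close>
definition cay_dist :: "('a, 'b) monoid_scheme \<Rightarrow> 'a set
    \<Rightarrow> ('a \<times> 'a \<times> real) \<Rightarrow> ('a \<times> 'a \<times> real) \<Rightarrow> real" where
  "cay_dist G S p q = (case p of (g, s, t) \<Rightarrow> case q of (h, r, u) \<Rightarrow>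
     (let wd = (\<lambda>x y. real (word_dist G S x y));
          E = min (min (t + wd g h + u) (t + wd g (h \<otimes>\<^bsub>G\<^esub> r) + (1 - u)))
                  (min ((1 - t) + wd (g \<otimes>\<^bsub>G\<^esub> s) h + u)
                       ((1 - t) + wd (g \<otimes>\<^bsub>G\<^esub> s) (h \<otimes>\<^bsub>G\<^esub> r) + (1 - u)))
      in if g = h \<and> s = r then min \<bar>t - u\<bar> E else E))"

definition cay_line :: "('a, 'b) monoid_scheme \<Rightarrow> 'a \<Rightarrow> real \<Rightarrow> ('a \<times> 'a \<times> real)" where
  "cay_line G a x = (a [^]\<^bsub>G\<^esub> \<lfloor>x\<rfloor>, a, x - of_int \<lfloor>x\<rfloor>)"

definition is_geodesic :: "('p \<Rightarrow> 'p \<Rightarrow> real) \<Rightarrow> (real \<Rightarrow> 'p) \<Rightarrow> bool" where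
  "is_geodesic d \<gamma> \<longleftrightarrow> (\<forall>x y. d (\<gamma> x) (\<gamma> y) = \<bar>x - y\<bar>)"

definition cproj :: "('p \<Rightarrow> 'p \<Rightarrow> real) \<Rightarrow> 'p set \<Rightarrow> 'p \<Rightarrow> 'p set" where
  "cproj d Y x = {y \<in> Y. d x y = (INF z\<in>Y. d x z)}"

definition strongly_contracting :: "'p set \<Rightarrow> ('p \<Rightarrow> 'p \<Rightarrow> real) \<Rightarrow> 'p set \<Rightarrow> bool" where
  "strongly_contracting X d Y \<longleftrightarrow> (\<exists>C. \<forall>x\<in>X. \<forall>x'\<in>X.
      d x x' \<le> (INF z\<in>Y. d x z) \<longrightarrow>
      (\<forall>y\<in>cproj d Y x \<union> cproj d Y x'. \<forall>y'\<in>cproj d Y x \<union> cproj d Y x'. d y y' \<le> C))"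

end

theory Submission
  imports Defs "HOL-Library.Countable"
begin

text \<open>
  Let \<open>G = \<langle>x, y, t | [x, y], t x = y t\<rangle>\<close> and \<open>s = x\<^sup>2 y\<^sup>-\<^sup>1\<close>, and let the generators be \<open>t\<close>, \<open>x\<close>, \<open>s\<close>,
  \<open>s\<^sup>-\<^sup>1 t\<close>, with \<open>x\<^sup>3\<close> added for the second generating set. All of them change the exponent sum of \<open>t\<close>
  by at most one, so the powers of \<open>t\<close> form a geodesic for both.

  In the first generating set the total exponent of \<open>x\<close> and \<open>y\<close> is 1-Lipschitz, so \<open>x\<^sup>r\<close> has
  distance at least \<open>r\<close> to the axis of \<open>t\<close>. On the other hand \<open>x\<^sup>2\<^sup>r s\<^sup>-\<^sup>r t = y\<^sup>r t = t x\<^sup>r\<close> leads from \<open>x\<^sup>2\<^sup>r\<close> to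
  \<open>t x\<^sup>r\<close> in \<open>r\<close> steps. Iterating, a point \<open>x\<^sup>r\<close> with \<open>r\<close> the \<open>n\<close>-th power of two has both \<open>1\<close> and
  \<open>t\<^sup>n\<close> in its projection.

  In the second generating set, \<open>x\<^sup>3\<close> makes the most efficient way from \<open>x\<^sup>j\<close> to the axis the direct one,
  of length about \<open>j / 3\<close>. A path whose position along the axis in the Bass--Serre tree increases
  meets points \<open>t\<^sup>k x\<^sup>j\<close> and \<open>t\<^sup>k\<^sup>+\<^sup>1 x\<^sup>i\<close>; the coordinates of the flat between them are 3-Lipschitz, so
  passing from one to the other costs at least \<open>\<bar>j\<bar> / 3\<close> and at least \<open>\<bar>i\<bar> / 3\<close>, as much as going to the
  axis up to a constant. Hence a path that gets far along the axis is longer than the distance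
  of its origin to the axis.
\<close>

section \<open>Word metrics\<close>

locale marked_group = group G for G (structure) +
  fixes S
  assumes S_carrier: "S \<subseteq> carrier G" and S_generates: "generate G S = carrier G"
begin

definition spells :: "nat \<Rightarrow> 'a \<Rightarrow> bool" where
  "spells n g \<longleftrightarrow> (\<exists>ws. length ws = n \<and> set ws \<subseteq> S \<union> m_inv G ` S
        \<and> foldr (\<lambda>x y. x \<otimes> y) ws \<one> = g)"

abbreviation wd :: "'a \<Rightarrow> 'a \<Rightarrow> nat" where "wd \<equiv> word_dist G S"

lemma inv_mult_cancel: "g \<in> carrier G \<Longrightarrow> h \<in> carrier G \<Longrightarrow> inv g \<otimes> (g \<otimes> h) = h"
  by (simp add: m_assoc[symmetric])

lemma mult_inv_cancel: "g \<in> carrier G \<Longrightarrow> h \<in> carrier G \<Longrightarrow> g \<otimes> (inv g \<otimes> h) = h"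
  by (simp add: m_assoc[symmetric])

lemma letters_carrier: "S \<union> m_inv G ` S \<subseteq> carrier G"
  using S_carrier by auto

lemma spells_0: "spells 0 g \<longleftrightarrow> g = \<one>"
  by (auto simp: spells_def)

lemma spells_Suc: "spells (Suc n) g \<longleftrightarrow> (\<exists>s\<in>S \<union> m_inv G ` S. \<exists>h. spells n h \<and> g = s \<otimes> h)"
proof
  assume "spells (Suc n) g"
  then obtain s ws where "length ws = n" "set (s # ws) \<subseteq> S \<union> m_inv G ` S"
      "foldr (\<lambda>x y. x \<otimes> y) (s # ws) \<one> = g"
    unfolding spells_def length_Suc_conv by blast
  then show "\<exists>s\<in>S \<union> m_inv G ` S. \<exists>h. spells n h \<and> g = s \<otimes> h"
    unfolding spells_def by (intro bexI[of _ s]) auto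
next
  assume "\<exists>s\<in>S \<union> m_inv G ` S. \<exists>h. spells n h \<and> g = s \<otimes> h"
  then obtain s ws where "length ws = n" "set (s # ws) \<subseteq> S \<union> m_inv G ` S"
      "foldr (\<lambda>x y. x \<otimes> y) (s # ws) \<one> = g"
    unfolding spells_def by auto
  then show "spells (Suc n) g"
    unfolding spells_def by (intro exI[of _ "s # ws"]) auto
qed

lemma spells_carrier: "spells n g \<Longrightarrow> g \<in> carrier G"
  using letters_carrier by (induction n arbitrary: g) (auto simp: spells_0 spells_Suc)

lemma spells_mult: "spells m g \<Longrightarrow> spells n h \<Longrightarrow> spells (m + n) (g \<otimes> h)"
proof (induction m arbitrary: g)
  case 0
  then show ?case using spells_carrier by (simp add: spells_0)
next
  case (Suc m)
  then obtain s k where sk: "s \<in> S \<union> m_inv G ` S" "spells m k" "g = s \<otimes> k"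
    by (auto simp: spells_Suc)
  have "g \<otimes> h = s \<otimes> (k \<otimes> h)"
    using sk letters_carrier Suc.prems spells_carrier by (metis m_assoc subsetD)
  then show ?case
    using sk Suc.IH Suc.prems(2) unfolding add_Suc spells_Suc by blast
qed

lemma spells_letter: "s \<in> S \<union> m_inv G ` S \<Longrightarrow> spells 1 s"
  unfolding One_nat_def spells_Suc spells_0 using letters_carrier
  by (intro bexI[of _ s] exI[of _ "\<one>"]) auto

lemma letters_inv: "s \<in> S \<union> m_inv G ` S \<Longrightarrow> inv s \<in> S \<union> m_inv G ` S"
  using S_carrier by auto

lemma spells_inv: "spells n g \<Longrightarrow> spells n (inv g)"
proof (induction n arbitrary: g)
  case 0
  then show ?case by (simp add: spells_0)
next
  case (Suc n)
  then obtain s k where sk: "s \<in> S \<union> m_inv G ` S" "spells n k" "g = s \<otimes> k"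
    by (auto simp: spells_Suc)
  have "inv g = inv k \<otimes> inv s"
    using sk letters_carrier spells_carrier by (metis inv_mult_group subsetD)
  then show ?case
    using spells_mult[OF Suc.IH[OF sk(2)] spells_letter[OF letters_inv[OF sk(1)]]] by simp
qed

lemma ex_spells:
  assumes "g \<in> carrier G"
  shows "\<exists>n. spells n g"
proof -
  have "g \<in> generate G S" using assms S_generates by simp
  then show ?thesis
  proof induction
    case one
    then show ?case using spells_0 by blast
  next
    case (incl h)
    then show ?case using spells_letter by blast
  next
    case (inv h)
    then show ?case using spells_letter by blast
  next
    case (eng h1 h2)
    then show ?case using spells_mult by blast
  qed
qed

lemma word_len_spells: "word_len G S g = (LEAST n. spells n g)"
  by (simp add: word_len_def spells_def)

lemma spells_word_len: "g \<in> carrier G \<Longrightarrow> spells (word_len G S g) g"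
  unfolding word_len_spells using ex_spells by (metis LeastI)

lemma word_len_le: "spells n g \<Longrightarrow> word_len G S g \<le> n"
  unfolding word_len_spells by (rule Least_le)

lemma wd_refl: "g \<in> carrier G \<Longrightarrow> wd g g = 0"
  using word_len_le[of 0 "\<one>"] by (simp add: word_dist_def spells_0)

lemma wd_commute: 
  assumes "g \<in> carrier G" "h \<in> carrier G"
  shows "wd g h = wd h g"
proof -
  have "word_len G S (inv k) \<le> word_len G S k" if "k \<in> carrier G" for k
    using word_len_le spells_inv spells_word_len that by blast
  moreover have "inv g \<otimes> h = inv (inv h \<otimes> g)" "inv h \<otimes> g = inv (inv g \<otimes> h)"
    using assms by (simp_all add: inv_mult_group)
  ultimately show ?thesis
    unfolding word_dist_def using assms by (metis inv_closed le_antisym m_closed)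
qed

lemma wd_triangle:
  assumes "g \<in> carrier G" "h \<in> carrier G" "k \<in> carrier G"
  shows "wd g k \<le> wd g h + wd h k"
proof -
  have "inv g \<otimes> k = (inv g \<otimes> h) \<otimes> (inv h \<otimes> k)"
    using assms by (simp add: m_assoc mult_inv_cancel)
  then show ?thesis
    unfolding word_dist_def using assms
    by (auto intro!: word_len_le spells_mult spells_word_len)
qed

lemma wd_left_mult:
  assumes "c \<in> carrier G" "g \<in> carrier G" "h \<in> carrier G"
  shows "wd (c \<otimes> g) (c \<otimes> h) = wd g h"
proof -
  have "inv (c \<otimes> g) \<otimes> (c \<otimes> h) = inv g \<otimes> h"
    using assms by (simp add: inv_mult_group m_assoc inv_mult_cancel)
  then show ?thesis by (simp add: word_dist_def)
qed

lemma wd_letter: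
  assumes "g \<in> carrier G" "s \<in> S \<union> m_inv G ` S"
  shows "wd g (g \<otimes> s) \<le> 1"
proof -
  have "inv g \<otimes> (g \<otimes> s) = s"
    using assms letters_carrier by (intro inv_mult_cancel) auto
  then show ?thesis
    using word_len_le[OF spells_letter[OF assms(2)]] by (simp add: word_dist_def)
qed

text \<open>A discrete intermediate value argument: follow a shortest word from \<open>g\<close> to
  \<open>h\<close> up to the first vertex satisfying \<open>Q\<close>. The final inequality says
  that this vertex lies on a geodesic.\<close>

lemma wd_crossing:
  assumes "g \<in> carrier G" "h \<in> carrier G" "\<not> Q g" "Q h"
  shows "\<exists>k\<in>carrier G. \<exists>s\<in>S \<union> m_inv G ` S. \<not> Q k \<and> Q (k \<otimes> s)
           \<and> wd g (k \<otimes> s) + wd (k \<otimes> s) h \<le> wd g h"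
proof -
  have "\<exists>k\<in>carrier G. \<exists>s\<in>S \<union> m_inv G ` S. \<not> Q k \<and> Q (k \<otimes> s)
           \<and> wd g (k \<otimes> s) + wd (k \<otimes> s) h \<le> n"
    if "spells n (inv g \<otimes> h)" "g \<in> carrier G" "\<not> Q g" for n g
    using that
  proof (induction n arbitrary: g)
    case 0
    then have "g = h" using assms(2) mult_inv_cancel[of g h] by (simp add: spells_0)
    then show ?case using 0 assms by simp
  next
    case (Suc n)
    then obtain s k where sk: "s \<in> S \<union> m_inv G ` S" "spells n k" "inv g \<otimes> h = s \<otimes> k"
      by (auto simp: spells_Suc)
    have sc: "s \<in> carrier G" "k \<in> carrier G" using sk letters_carrier spells_carrier by auto
    have gs: "g \<otimes> s \<in> carrier G" using sc Suc.prems by simp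
    have "h = g \<otimes> (s \<otimes> k)"
      using mult_inv_cancel[of g h] Suc.prems(2) assms(2) unfolding sk(3) by simp
    then have k: "inv (g \<otimes> s) \<otimes> h = k"
      using sc Suc.prems(2) inv_mult_cancel[OF gs, of k] by (simp add: m_assoc)
    have step: "wd g (g \<otimes> s) \<le> 1" using wd_letter sk Suc.prems by blast
    show ?case
    proof (cases "Q (g \<otimes> s)")
      case True
      have "wd (g \<otimes> s) h \<le> n" using k sk(2) word_len_le by (simp add: word_dist_def)
      then show ?thesis using True step sk(1) Suc.prems
        by (intro bexI[of _ g] bexI[of _ s]) auto
    next
      case False
      then obtain k' s' where k': "k' \<in> carrier G" "s' \<in> S \<union> m_inv G ` S" "\<not> Q k'" "Q (k' \<otimes> s')"
           "wd (g \<otimes> s) (k' \<otimes> s') + wd (k' \<otimes> s') h \<le> n"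
        using Suc.IH[of "g \<otimes> s"] k sk(2) gs by metis
      have "k' \<otimes> s' \<in> carrier G" using k' letters_carrier by auto
      then have "wd g (k' \<otimes> s') \<le> wd g (g \<otimes> s) + wd (g \<otimes> s) (k' \<otimes> s')"
        using wd_triangle gs Suc.prems by blast
      then show ?thesis using k' step
        by (intro bexI[of _ k'] bexI[of _ s']) auto
    qed
  qed
  then show ?thesis
    using assms spells_word_len by (simp add: word_dist_def)
qed

text \<open>A step along an inverse letter is a step along a generator traversed backwards; the
  bounds are then added up along a shortest word.\<close>

lemma lipschitz_le_wd:
  fixes F :: "'a \<Rightarrow> int"
  assumes F: "\<And>g s. g \<in> carrier G \<Longrightarrow> s \<in> S \<Longrightarrow> \<bar>F (g \<otimes> s) - F g\<bar> \<le> c"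
    and "g \<in> carrier G" "h \<in> carrier G"
  shows "\<bar>F h - F g\<bar> \<le> c * int (wd g h)"
proof -
  have step: "\<bar>F (g \<otimes> s) - F g\<bar> \<le> c" if g: "g \<in> carrier G" and s: "s \<in> S \<union> m_inv G ` S" for g s
  proof (cases "s \<in> S")
    case True
    then show ?thesis using F g by blast
  next
    case False
    then obtain r where r: "r \<in> S" "s = inv r" using s by blast
    then have "(g \<otimes> s) \<otimes> r = g" "g \<otimes> s \<in> carrier G"
      using g S_carrier by (auto simp: m_assoc subset_iff)
    then show ?thesis using F[of "g \<otimes> s" r] r(1) by (simp add: abs_minus_commute)
  qed
  have "\<bar>F (g \<otimes> k) - F g\<bar> \<le> c * int n" if "spells n k" "g \<in> carrier G" for n k g
    using that
  proof (induction n arbitrary: g k)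
    case 0
    then show ?case by (simp add: spells_0)
  next
    case (Suc n)
    then obtain s l where sl: "s \<in> S \<union> m_inv G ` S" "spells n l" "k = s \<otimes> l"
      by (auto simp: spells_Suc)
    have sc: "s \<in> carrier G" "l \<in> carrier G" using sl letters_carrier spells_carrier by auto
    have "g \<otimes> k = (g \<otimes> s) \<otimes> l" using sl sc Suc.prems by (simp add: m_assoc)
    moreover have "\<bar>F ((g \<otimes> s) \<otimes> l) - F (g \<otimes> s)\<bar> \<le> c * int n"
      using Suc.IH sl(2) sc Suc.prems by simp
    moreover have "\<bar>F (g \<otimes> s) - F g\<bar> \<le> c" using step sl(1) Suc.prems by blast
    ultimately show ?case by (simp add: algebra_simps)
  qed
  from this[of "word_len G S (inv g \<otimes> h)" "inv g \<otimes> h" g]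
  show ?thesis
    using assms(2,3) spells_word_len by (simp add: word_dist_def mult_inv_cancel)
qed

section \<open>The metric graph\<close>

text \<open>The two exits from the edge of a point, with their distances; they turn the fourfold
  minimum in \<open>cay_dist\<close> into a choice of one exit on either side.\<close>

definition ends :: "'a \<times> 'a \<times> real \<Rightarrow> ('a \<times> real) set" where
  "ends p = (case p of (g, s, t) \<Rightarrow> {(g, t), (g \<otimes> s, 1 - t)})"

lemma cay_dist_le_ends:
  assumes "(g, t) \<in> ends p" "(h, u) \<in> ends q"
  shows "cay_dist G S p q \<le> t + wd g h + u"
  using assms unfolding ends_def cay_dist_def Let_def by (auto split: prod.splits)

lemma cay_dist_cases:
  obtains "fst p = fst q" "fst (snd p) = fst (snd q)"
          "cay_dist G S p q = \<bar>snd (snd p) - snd (snd q)\<bar>"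
  | g t h u where "(g, t) \<in> ends p" "(h, u) \<in> ends q" "cay_dist G S p q = t + wd g h + u"
proof -
  obtain g s t h r u where pq: "p = (g, s, t)" "q = (h, r, u)"
    by (metis surj_pair)
  let ?d = "cay_dist G S p q"
  consider "g = h \<and> s = r \<and> ?d = \<bar>t - u\<bar>" | "?d = t + wd g h + u"
    | "?d = t + wd g (h \<otimes> r) + (1 - u)" | "?d = (1 - t) + wd (g \<otimes> s) h + u"
    | "?d = (1 - t) + wd (g \<otimes> s) (h \<otimes> r) + (1 - u)"
    unfolding pq cay_dist_def Let_def prod.case min_def by (simp split: if_splits) argo
  then show ?thesis
  proof cases
    case 1
    then have "fst p = fst q" "fst (snd p) = fst (snd q)"
      "?d = \<bar>snd (snd p) - snd (snd q)\<bar>"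
      unfolding pq by auto
    then show ?thesis by (rule that(1))
  qed (rule that(2)[rotated 2], assumption, simp add: pq ends_def, simp add: pq ends_def)+
qed

lemma ends_nonneg: "p \<in> cay_points G S \<Longrightarrow> (g, t) \<in> ends p \<Longrightarrow> 0 \<le> t"
  by (auto simp: cay_points_def ends_def)

lemma ends_carrier: "p \<in> cay_points G S \<Longrightarrow> (g, t) \<in> ends p \<Longrightarrow> g \<in> carrier G"
  using S_carrier by (auto simp: cay_points_def ends_def)

lemma cay_dist_nonneg:
  assumes "p \<in> cay_points G S" "q \<in> cay_points G S"
  shows "0 \<le> cay_dist G S p q"
proof (cases rule: cay_dist_cases[of p q])
  case (2 g t h u)
  then show ?thesis
    using assms ends_nonneg[of p g t] ends_nonneg[of q h u] by simp
qed simp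

lemma cay_line_points: "a \<in> S \<Longrightarrow> cay_line G a x \<in> cay_points G S"
  unfolding cay_line_def cay_points_def using S_carrier
  by (auto simp: int_pow_closed subset_iff) linarith

lemma INF_cay_line_le:
  assumes "a \<in> S" "p \<in> cay_points G S"
  shows "(INF z\<in>range (cay_line G a). cay_dist G S p z) \<le> cay_dist G S p (cay_line G a x)"
proof (rule cINF_lower)
  show "bdd_below (cay_dist G S p ` range (cay_line G a))"
    using cay_dist_nonneg[OF assms(2) cay_line_points[OF assms(1)]] by (intro bdd_belowI2[of _ 0]) auto
qed simp

lemma is_geodesic_cay_line:
  assumes a: "a \<in> S" and wd: "\<And>m n. wd (a [^] (m::int)) (a [^] (n::int)) = nat \<bar>m - n\<bar>"
  shows "is_geodesic (cay_dist G S) (cay_line G a)"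
  unfolding is_geodesic_def
proof (intro allI)
  fix x y :: real
  define m where "m = \<lfloor>x\<rfloor>"
  define n where "n = \<lfloor>y\<rfloor>"
  have mn: "of_int m \<le> x" "x < of_int m + 1" "of_int n \<le> y" "y < of_int n + 1"
    unfolding m_def n_def by linarith+
  have suc: "a [^] k \<otimes> a = a [^] (k + 1)" for k :: int
    using a S_carrier by (metis int_pow_1 int_pow_mult subsetD)
  \<comment> \<open>Equal powers are at distance 0, so different indices give different edges, and
    the same-edge clause of \<open>cay_dist\<close> fires only for \<open>m = n\<close>.\<close>
  have inj: "m = n" if "a [^] m = a [^] n"
  proof -
    have "wd (a [^] m) (a [^] n) = 0"
      using that a S_carrier wd_refl by (metis int_pow_closed subsetD)
    then show ?thesis by (simp add: wd)
  qed
  have r: "real (nat \<bar>k\<bar>) = \<bar>of_int k\<bar>" for k :: int by simp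
  consider "m = n" | "m + 1 \<le> n" | "n + 1 \<le> m" by linarith
  then have E: "cay_dist G S (a [^] m, a, x - of_int m) (a [^] n, a, y - of_int n) = \<bar>x - y\<bar>"
  proof cases
    case 1
    then show ?thesis
      unfolding cay_dist_def Let_def prod.case suc wd r using mn
      by (simp add: min_def abs_real_def)
  next
    case 2
    then have "real_of_int m + 1 \<le> of_int n" by linarith
    moreover have "a [^] m \<noteq> a [^] n" using inj 2 by auto
    ultimately show ?thesis
      unfolding cay_dist_def Let_def prod.case suc wd r using mn by (simp add: min_def)
  next
    case 3
    then have "real_of_int n + 1 \<le> of_int m" by linarith
    moreover have "a [^] m \<noteq> a [^] n" using inj 3 by auto
    ultimately show ?thesis
      unfolding cay_dist_def Let_def prod.case suc wd r using mn by (simp add: min_def)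
  qed
  then show "cay_dist G S (cay_line G a x) (cay_line G a y) = \<bar>x - y\<bar>"
    by (simp add: cay_line_def m_def n_def)
qed

text \<open>Reduces strong contraction to vertices: a coarse projection \<open>\<pi>\<close> has to
  vary boundedly between a vertex \<open>g\<close> and any \<open>h\<close> that is no farther from
  \<open>g\<close> than every power of \<open>a\<close>.\<close>

lemma strongly_contracting_cay_line:
  fixes \<pi> :: "'a \<Rightarrow> int"
  assumes a: "a \<in> S" and geo: "is_geodesic (cay_dist G S) (cay_line G a)"
    and \<pi>_pow: "\<And>n. \<pi> (a [^] (n::int)) = n"
    and \<pi>_step: "\<And>g s. g \<in> carrier G \<Longrightarrow> s \<in> S \<Longrightarrow> \<bar>\<pi> (g \<otimes> s) - \<pi> g\<bar> \<le> 1"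
    and \<pi>_wd: "\<And>g h. g \<in> carrier G \<Longrightarrow> h \<in> carrier G \<Longrightarrow>
        (\<And>n. wd g h \<le> wd g (a [^] (n::int))) \<Longrightarrow> \<bar>\<pi> g - \<pi> h\<bar> \<le> B"
  shows "strongly_contracting (cay_points G S) (cay_dist G S) (range (cay_line G a))"
proof -
  let ?d = "cay_dist G S" and ?X = "cay_points G S" and ?Y = "range (cay_line G a)"
  have B0: "0 \<le> B" using \<pi>_wd[of "\<one>" "\<one>"] wd_refl by simp
  have ends_\<pi>: "\<bar>\<pi> g - \<pi> (fst p)\<bar> \<le> 1" if "p \<in> ?X" "(g, t) \<in> ends p" for p g t
    using that \<pi>_step by (auto simp: cay_points_def ends_def)
  have near: "\<bar>\<pi> (fst p) - \<pi> (fst q)\<bar> \<le> B + 2"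
    if p: "p \<in> ?X" and q: "q \<in> ?X" and d: "?d p q \<le> (INF z\<in>?Y. ?d p z)" for p q
  proof (cases rule: cay_dist_cases[of p q])
    case 1
    then show ?thesis using B0 by simp
  next
    case (2 g t h u)
    \<comment> \<open>Going from \<open>p\<close> to a power of \<open>a\<close> through the exit
      \<open>g\<close> costs the same initial \<open>t\<close> as going to \<open>q\<close>, so
      \<open>t\<close> cancels and the hypothesis passes from points to vertices.\<close>
    have "wd g h \<le> wd g (a [^] n)" for n :: int
    proof -
      have "(a [^] n, 0) \<in> ends (cay_line G a (of_int n))"
        by (simp add: ends_def cay_line_def)
      then have "?d p (cay_line G a (of_int n)) \<le> t + wd g (a [^] n) + 0"
        using 2(1) cay_dist_le_ends by blast
      then have "t + wd g h + u \<le> t + wd g (a [^] n)"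
        using d 2(3) INF_cay_line_le[OF a p, of "of_int n"] by linarith
      then show ?thesis using ends_nonneg[OF q 2(2)] by linarith
    qed
    then have "\<bar>\<pi> g - \<pi> h\<bar> \<le> B"
      using \<pi>_wd ends_carrier p q 2 by blast
    then show ?thesis using ends_\<pi>[OF p 2(1)] ends_\<pi>[OF q 2(2)] by linarith
  qed
  \<comment> \<open>A projection point realises the infimum, so it is itself an admissible
    \<open>q\<close> in \<open>near\<close>.\<close>
  have proj: "\<bar>\<pi> (fst p) - \<lfloor>z\<rfloor>\<bar> \<le> B + 2" if "p \<in> ?X" "cay_line G a z \<in> cproj ?d ?Y p" for p z
  proof -
    have "fst (cay_line G a z) = a [^] \<lfloor>z\<rfloor>" by (simp add: cay_line_def)
    then show ?thesis
      using near[of p "cay_line G a z"] that cay_line_points[OF a] by (simp add: cproj_def \<pi>_pow)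
  qed
  show ?thesis
    unfolding strongly_contracting_def
  proof (intro exI ballI impI)
    fix p q y y'
    assume p: "p \<in> ?X" and q: "q \<in> ?X" and d: "?d p q \<le> (INF z\<in>?Y. ?d p z)"
      and y: "y \<in> cproj ?d ?Y p \<union> cproj ?d ?Y q" and y': "y' \<in> cproj ?d ?Y p \<union> cproj ?d ?Y q"
    obtain z z' where z: "y = cay_line G a z" "y' = cay_line G a z'"
      using y y' by (auto simp: cproj_def)
    \<comment> \<open>At worst \<open>y\<close> and \<open>y'\<close> are projections of different
      points: three jumps of at most \<open>B + 2\<close>, by way of \<open>p\<close> and
      \<open>q\<close>.\<close>
    have "\<bar>\<lfloor>z\<rfloor> - \<lfloor>z'\<rfloor>\<bar> \<le> 3 * B + 6"
      using near[OF p q d] y y' proj[OF p, of z] proj[OF q, of z] proj[OF p, of z'] proj[OF q, of z'] B0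
      unfolding z Un_iff by linarith
    then have "\<bar>of_int \<lfloor>z\<rfloor> - of_int \<lfloor>z'\<rfloor>\<bar> \<le> real_of_int (3 * B + 6)"
      by linarith
    then have "\<bar>z - z'\<bar> \<le> real_of_int (3 * B + 6) + 1" by linarith
    then show "?d y y' \<le> real_of_int (3 * B + 6) + 1"
      using geo z by (simp add: is_geodesic_def)
  qed
qed

end

section \<open>The HNN extension of the free abelian group of rank two\<close>

text \<open>A state \<open>([(c\<^sub>n, e\<^sub>n), \<dots>, (c\<^sub>1, e\<^sub>1)], i, j)\<close> is the Britton normal form
  \<open>r\<^sub>1 \<dots> r\<^sub>n x\<^sup>i y\<^sup>j\<close>, where \<open>r\<^sub>k\<close> is \<open>x\<close> to the power \<open>c\<^sub>k\<close> times \<open>t\<close> if \<open>e\<^sub>k\<close> holds, and \<open>y\<close> to the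
  power \<open>c\<^sub>k\<close> times the inverse of \<open>t\<close> otherwise. The functions \<open>shift\<close>, \<open>tmul\<close>, \<open>tinv\<close>
  are right multiplication by \<open>x\<^sup>p y\<^sup>q\<close>, \<open>t\<close> and the inverse of \<open>t\<close>, using \<open>y t = t x\<close>.\<close>

type_synonym state = "(int \<times> bool) list \<times> int \<times> int"

text \<open>The head of the list is the last syllable. What is forbidden is a pinch: a syllable with
  trivial coset representative that undoes the stable letter just before it.\<close>

fun reduced :: "(int \<times> bool) list \<Rightarrow> bool" where
  "reduced (a # b # l) \<longleftrightarrow> \<not> (fst a = 0 \<and> snd a \<noteq> snd b) \<and> reduced (b # l)"
| "reduced _ \<longleftrightarrow> True"

definition states :: "state set" where
  "states = {w. reduced (fst w)}"

fun shift :: "int \<Rightarrow> int \<Rightarrow> state \<Rightarrow> state" where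
  "shift p q (l, i, j) = (l, i + p, j + q)"

fun tmul :: "state \<Rightarrow> state" where
  "tmul (l, i, j) = (if l \<noteq> [] \<and> \<not> snd (hd l) \<and> i = 0 then (tl l, j, fst (hd l))
     else ((i, True) # l, j, 0))"

fun tinv :: "state \<Rightarrow> state" where
  "tinv (l, i, j) = (if l \<noteq> [] \<and> snd (hd l) \<and> j = 0 then (tl l, fst (hd l), i)
     else ((j, False) # l, 0, i))"

lemma reduced_Cons:
  "reduced (a # l) \<longleftrightarrow> reduced l \<and> (l \<noteq> [] \<longrightarrow> fst a = 0 \<longrightarrow> snd a = snd (hd l))"
  by (cases l) auto

lemma states_shift: "w \<in> states \<Longrightarrow> shift p q w \<in> states"
  by (cases w) (simp add: states_def)

lemma states_tmul: "w \<in> states \<Longrightarrow> tmul w \<in> states"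
  by (cases w; cases "fst w") (auto simp: states_def reduced_Cons)

lemma states_tinv: "w \<in> states \<Longrightarrow> tinv w \<in> states"
  by (cases w; cases "fst w") (auto simp: states_def reduced_Cons)

lemma shift_shift: "shift p q (shift p' q' w) = shift (p + p') (q + q') w"
  by (cases w) simp

lemma shift_0: "shift 0 0 w = w"
  by (cases w) simp

lemma tinv_tmul: "w \<in> states \<Longrightarrow> tinv (tmul w) = w"
  by (cases w; cases "fst w") (auto simp: states_def reduced_Cons)

lemma tmul_tinv: "w \<in> states \<Longrightarrow> tmul (tinv w) = w"
  by (cases w; cases "fst w") (auto simp: states_def reduced_Cons)

text \<open>The relation y^q t = t x^q; the case distinction in \<open>tmul\<close> is unaffected,
  as it does not look at the exponent of y.\<close>

lemma tmul_shift: "tmul (shift 0 q w) = shift q 0 (tmul w)"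
  by (cases w) auto

lemma tinv_shift: "tinv (shift p 0 w) = shift 0 p (tinv w)"
  by (cases w) auto

section \<open>Multiplication of normal forms\<close>

primrec stack_act :: "(int \<times> bool) list \<Rightarrow> state \<Rightarrow> state" where
  "stack_act [] w = w"
| "stack_act (a # l) w = (if snd a then tmul (shift (fst a) 0 (stack_act l w))
     else tinv (shift 0 (fst a) (stack_act l w)))"

text \<open>This is the product of \<open>w\<close> with the first argument on its right.\<close>

fun act :: "state \<Rightarrow> state \<Rightarrow> state" where
  "act (l, i, j) w = shift i j (stack_act l w)"

lemma states_stack_act: "w \<in> states \<Longrightarrow> stack_act l w \<in> states"
  by (induction l) (auto intro: states_shift states_tmul states_tinv)

lemma states_act: "w \<in> states \<Longrightarrow> act v w \<in> states"
  by (cases v) (auto intro: states_shift states_stack_act)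

lemma act_shift: "act (shift p q v) w = shift p q (act v w)"
  by (cases v) (simp add: shift_shift add.commute)

text \<open>Left multiplication commutes with right multiplication by t, the core of associativity.
  If \<open>tmul\<close> pops a syllable of \<open>v\<close>, \<open>tmul_tinv\<close> cancels its
  t^-1; if it pushes one, \<open>tmul_shift\<close> moves y^j across t.\<close>

lemma act_tmul:
  assumes "w \<in> states"
  shows "act (tmul v) w = tmul (act v w)"
proof -
  obtain l i j where v: "v = (l, i, j)" by (metis surj_pair)
  show ?thesis
  proof (cases "l \<noteq> [] \<and> \<not> snd (hd l) \<and> i = 0")
    case True
    then obtain c m where l: "l = (c, False) # m" by (cases l) auto
    have n: "shift 0 c (stack_act m w) \<in> states"
      using assms by (intro states_shift states_stack_act)
    show ?thesis
      using True unfolding v l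
      by (simp add: tmul_shift tmul_tinv[OF n] shift_shift)
  next
    case False
    then have "act (tmul v) w = shift j 0 (tmul (shift i 0 (stack_act l w)))"
      by (auto simp: v)
    also have "\<dots> = tmul (shift i j (stack_act l w))"
      by (simp flip: tmul_shift add: shift_shift)
    finally show ?thesis by (simp add: v)
  qed
qed

lemma act_tinv:
  assumes "w \<in> states"
  shows "act (tinv v) w = tinv (act v w)"
proof -
  obtain l i j where v: "v = (l, i, j)" by (metis surj_pair)
  show ?thesis
  proof (cases "l \<noteq> [] \<and> snd (hd l) \<and> j = 0")
    case True
    then obtain c m where l: "l = (c, True) # m" by (cases l) auto
    have n: "shift c 0 (stack_act m w) \<in> states"
      using assms by (intro states_shift states_stack_act)
    show ?thesis
      using True unfolding v l
      by (simp add: tinv_shift tinv_tmul[OF n] shift_shift)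
  next
    case False
    then have "act (tinv v) w = shift 0 i (tinv (shift 0 j (stack_act l w)))"
      by (auto simp: v)
    also have "\<dots> = tinv (shift i j (stack_act l w))"
      by (simp flip: tinv_shift add: shift_shift)
    finally show ?thesis by (simp add: v)
  qed
qed

lemma act_stack_act: "w \<in> states \<Longrightarrow> act (stack_act l v) w = stack_act l (act v w)"
  by (induction l) (auto simp: act_tmul act_tinv act_shift)

lemma act_act: "w \<in> states \<Longrightarrow> act (act u v) w = act u (act v w)"
  by (cases u) (simp add: act_shift act_stack_act)

lemma act_one_right: "act v ([], 0, 0) = v" if "v \<in> states"
proof -
  have "stack_act l ([], 0, 0) = (l, 0, 0)" if "reduced l" for l
    using that
  proof (induction l)
    case (Cons a l)
    then have "stack_act l ([], 0, 0) = (l, 0, 0)" by (simp add: reduced_Cons)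
    then show ?case using Cons.prems by (cases a) (auto simp: reduced_Cons)
  qed simp
  then show ?thesis using that by (cases v) (simp add: states_def)
qed

text \<open>The syllables of \<open>u\<close> are undone one by one, starting from the last. With
  the identity for \<open>v\<close> this gives left inverses.\<close>

lemma ex_act_eq:
  assumes "v \<in> states"
  shows "\<exists>w\<in>states. act u w = v"
proof -
  obtain l i j where u: "u = (l, i, j)" by (metis surj_pair)
  have "\<exists>w\<in>states. stack_act l w = v" if "v \<in> states" for v
    using that
  proof (induction l arbitrary: v)
    case (Cons a l)
    show ?case
    proof (cases "snd a")
      case True
      obtain w where w: "w \<in> states" "stack_act l w = shift (- fst a) 0 (tinv v)"
        using Cons states_shift states_tinv by meson
      then show ?thesis
        using True Cons.prems by (intro bexI[of _ w]) (simp_all add: shift_shift shift_0 tmul_tinv)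
    next
      case False
      obtain w where w: "w \<in> states" "stack_act l w = shift 0 (- fst a) (tmul v)"
        using Cons states_shift states_tmul by meson
      then show ?thesis
        using False Cons.prems by (intro bexI[of _ w]) (simp_all add: shift_shift shift_0 tinv_tmul)
    qed
  qed auto
  from this[OF states_shift[OF assms, of "-i" "-j"]]
  show ?thesis by (auto simp: u shift_shift shift_0 intro!: bexI)
qed

text \<open>The states are encoded as natural numbers because the theorem asks for a
  \<open>nat monoid\<close>. The arguments are swapped because \<open>act\<close> multiplies on the
  right.\<close>

definition hnn :: "nat monoid" where
  "hnn = \<lparr>carrier = to_nat ` states,
     mult = (\<lambda>a b. to_nat (act (from_nat b) (from_nat a))),
     one = to_nat (([], 0, 0) :: state)\<rparr>"

definition el :: "state \<Rightarrow> nat" where "el = to_nat"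

definition st :: "nat \<Rightarrow> state" where "st = from_nat"

lemma st_el [simp]: "st (el w) = w"
  by (simp add: st_def el_def)

lemma hnn_carrier: "carrier hnn = el ` states"
  by (simp add: hnn_def el_def)

lemma hnn_mult: "el v \<otimes>\<^bsub>hnn\<^esub> el w = el (act w v)"
  by (simp add: hnn_def el_def)

lemma hnn_one: "\<one>\<^bsub>hnn\<^esub> = el ([], 0, 0)"
  by (simp add: hnn_def el_def)

lemma el_closed: "w \<in> states \<Longrightarrow> el w \<in> carrier hnn"
  by (simp add: hnn_carrier)

lemma group_hnn: "group hnn"
proof (rule groupI)
  fix g h k
  assume "g \<in> carrier hnn" "h \<in> carrier hnn" "k \<in> carrier hnn"
  then show "g \<otimes>\<^bsub>hnn\<^esub> h \<otimes>\<^bsub>hnn\<^esub> k = g \<otimes>\<^bsub>hnn\<^esub> (h \<otimes>\<^bsub>hnn\<^esub> k)"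
    by (auto simp: hnn_carrier hnn_mult act_act simp del: act.simps)
next
  fix g assume "g \<in> carrier hnn"
  then obtain v where v: "v \<in> states" "g = el v" by (auto simp: hnn_carrier)
  have "([], 0, 0) \<in> states" by (simp add: states_def)
  then obtain w where "w \<in> states" "act v w = ([], 0, 0)" using ex_act_eq by blast
  then show "\<exists>h\<in>carrier hnn. h \<otimes>\<^bsub>hnn\<^esub> g = \<one>\<^bsub>hnn\<^esub>"
    using v by (intro bexI[of _ "el w"]) (simp_all add: hnn_mult hnn_one el_closed)
qed (auto simp: hnn_carrier hnn_mult hnn_one states_act act_one_right simp del: act.simps,
    simp_all add: states_def)

interpretation hnn: group hnn by (rule group_hnn)

abbreviation t :: nat where "t \<equiv> el ([(0, True)], 0, 0)"

abbreviation v :: "int \<Rightarrow> int \<Rightarrow> nat" where "v i j \<equiv> el ([], i, j)"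

text \<open>The last generator is the product of \<open>v (-2) 1\<close>, the inverse of \<open>v 2 (-1)\<close>, with \<open>t\<close>.\<close>

definition gens :: "nat set" where
  "gens = {t, v 1 0, v 2 (-1), el ([(-2, True)], 1, 0)}"

definition gens' :: "nat set" where
  "gens' = insert (v 3 0) gens"

lemma mult_t: "el w \<otimes>\<^bsub>hnn\<^esub> t = el (tmul w)"
  by (simp add: hnn_mult shift_0)

lemma mult_v: "el w \<otimes>\<^bsub>hnn\<^esub> v i j = el (shift i j w)"
  by (simp add: hnn_mult)

text \<open>The normal form on the left is that of x^-2 y t, since y t = t x.\<close>

lemma mult_vt: "el w \<otimes>\<^bsub>hnn\<^esub> el ([(-2, True)], 1, 0) = el (tmul (shift (-2) 1 w))"
  by (simp add: hnn_mult flip: tmul_shift add: shift_shift)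

lemma gens'_carrier: "gens' \<subseteq> carrier hnn"
  by (auto simp: gens'_def gens_def intro!: el_closed) (simp_all add: states_def)

text \<open>From t and x one gets y = t x t^-1, and then every normal form syllable by
  syllable.\<close>

lemma generate_gens: "generate hnn gens = carrier hnn"
proof
  show "generate hnn gens \<subseteq> carrier hnn"
    using gens'_carrier by (intro hnn.generate_incl) (auto simp: gens'_def)
next
  interpret H: subgroup "generate hnn gens" hnn
    using gens'_carrier by (intro hnn.generate_is_subgroup) (auto simp: gens'_def)
  let ?H = "generate hnn gens"
  have t: "t \<in> ?H" and x: "v 1 0 \<in> ?H" by (auto simp: gens_def intro: generate.incl)
  have norm: "([], i, j) \<in> states" for i j by (simp add: states_def)
  have vinv: "inv\<^bsub>hnn\<^esub> (v i j) = v (-i) (-j)" for i j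
    by (rule hnn.inv_equality) (auto simp: mult_v hnn_one norm intro!: el_closed)
  have tinv: "el w \<otimes>\<^bsub>hnn\<^esub> inv\<^bsub>hnn\<^esub> t = el (tinv w)" if "w \<in> states" for w
  proof -
    have "el (tinv w) \<otimes>\<^bsub>hnn\<^esub> t = el w" by (simp add: mult_t tmul_tinv that del: tmul.simps tinv.simps)
    moreover have "t \<in> carrier hnn" "el (tinv w) \<in> carrier hnn" "el w \<in> carrier hnn"
      using that states_tinv[OF that] by (auto intro!: el_closed simp: states_def simp del: tinv.simps)
    ultimately show ?thesis by (metis hnn.inv_solve_right)
  qed
  have "v (int n) 0 \<in> ?H" for n
  proof (induction n)
    case 0
    then show ?case using H.one_closed by (simp add: hnn_one)
  next
    case (Suc n)
    have "v (int (Suc n)) 0 = v (int n) 0 \<otimes>\<^bsub>hnn\<^esub> v 1 0" by (simp add: mult_v add.commute)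
    then show ?case using Suc x by (metis H.m_closed)
  qed
  then have xi: "v i 0 \<in> ?H" for i
    by (cases i rule: int_cases2) (auto dest: H.m_inv_closed simp: vinv, 
        metis H.m_inv_closed add.inverse_neutral vinv)
  have yj: "v 0 j \<in> ?H" for j
  proof -
    have "v 0 j = t \<otimes>\<^bsub>hnn\<^esub> v j 0 \<otimes>\<^bsub>hnn\<^esub> inv\<^bsub>hnn\<^esub> t"
      by (simp add: mult_v tinv states_def)
    then show ?thesis using t xi by (metis H.m_closed H.m_inv_closed)
  qed
  have stack: "el (l, 0, 0) \<in> ?H" if "reduced l" for l
    using that
  proof (induction l)
    case Nil
    then show ?case using H.one_closed by (simp add: hnn_one)
  next
    case (Cons a l)
    then have l: "reduced l" "el (l, 0, 0) \<in> ?H" by (auto simp: reduced_Cons)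
    obtain c e where a: "a = (c, e)" by fastforce
    show ?case
    proof (cases e)
      case True
      then have "el (a # l, 0, 0) = el (l, 0, 0) \<otimes>\<^bsub>hnn\<^esub> v c 0 \<otimes>\<^bsub>hnn\<^esub> t"
        using Cons.prems by (auto simp: a mult_v mult_t reduced_Cons)
      then show ?thesis using l xi t by (metis H.m_closed)
    next
      case False
      then have "el (a # l, 0, 0) = el (l, 0, 0) \<otimes>\<^bsub>hnn\<^esub> v 0 c \<otimes>\<^bsub>hnn\<^esub> inv\<^bsub>hnn\<^esub> t"
        using Cons.prems l(1) by (auto simp: a mult_v tinv reduced_Cons states_def)
      then show ?thesis using l yj t by (metis H.m_closed H.m_inv_closed)
    qed
  qed
  show "carrier hnn \<subseteq> ?H"
  proof
    fix g assume "g \<in> carrier hnn"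
    then obtain l i j where g: "g = el (l, i, j)" "reduced l"
      by (auto simp: hnn_carrier states_def)
    then have "g = el (l, 0, 0) \<otimes>\<^bsub>hnn\<^esub> v i 0 \<otimes>\<^bsub>hnn\<^esub> v 0 j" by (simp add: mult_v)
    then show "g \<in> ?H" using stack[OF g(2)] xi yj by (metis H.m_closed)
  qed
qed

interpretation X: marked_group hnn gens
  using gens'_carrier generate_gens by unfold_locales (auto simp: gens'_def)

interpretation X': marked_group hnn gens'
proof
  have "generate hnn gens \<subseteq> generate hnn gens'"
    by (rule hnn.mono_generate) (auto simp: gens'_def)
  then show "generate hnn gens' = carrier hnn"
    using generate_gens hnn.generate_incl[OF gens'_carrier] by blast
qed (rule gens'_carrier)

section \<open>Lipschitz functions on normal forms\<close>

fun xsum :: "state \<Rightarrow> int" where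
  "xsum (l, i, j) = i + j + sum_list (map fst l)"

fun tsum :: "state \<Rightarrow> int" where
  "tsum (l, i, j) = (\<Sum>a\<leftarrow>l. if snd a then 1 else - 1)"

text \<open>The exponent of \<open>x\<close> (if \<open>b\<close>) or of \<open>y\<close> (otherwise) of the point at which the path described by a
  normal form leaves the flat spanned by \<open>x\<close> and \<open>y\<close>. On branches attached along a line on which this
  exponent varies, it is extended by the total exponent, which makes it Lipschitz.\<close>

fun coord :: "bool \<Rightarrow> state \<Rightarrow> int" where
  "coord b (l, i, j) = (if l = [] then if b then i else j
     else if snd (last l) = b then fst (last l) else xsum (l, i, j) - fst (last l))"

text \<open>The first syllable of a normal form is at the end of the list, hence the
  \<open>rev\<close>.\<close>

definition lead :: "'b \<Rightarrow> 'b list \<Rightarrow> nat" where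
  "lead c l = length (takeWhile ((=) c) (rev l))"

text \<open>The index of the vertex of the axis of \<open>t\<close> in the Bass--Serre tree that is nearest to the
  vertex with stack \<open>l\<close>.\<close>

definition axis :: "(int \<times> bool) list \<Rightarrow> int" where
  "axis l = int (lead (0, True) l) - int (lead (0, False) l)"

definition run :: "int \<Rightarrow> (int \<times> bool) list" where
  "run k = replicate (nat k) (0, True) @ replicate (nat (- k)) (0, False)"

lemma xsum_shift: "xsum (shift p q w) = xsum w + p + q"
  by (cases w) simp

text \<open>Moving t across a power of y turns it into a power of x, which the total exponent does
  not see.\<close>

lemma xsum_tmul: "xsum (tmul w) = xsum w"
  by (cases w; cases "fst w") auto

lemma tsum_shift: "tsum (shift p q w) = tsum w"
  by (cases w) simp

lemma tsum_tmul: "tsum (tmul w) = tsum w + 1"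
  by (cases w; cases "fst w") auto

lemma coord_shift: "\<bar>coord b (shift p q w) - coord b w\<bar> \<le> \<bar>p\<bar> + \<bar>q\<bar>"
  by (cases w) auto

text \<open>The critical case is a stack that becomes empty or stops being so. There the bottom
  syllable records one coordinate of the flat, and the total exponent minus it is the other.\<close>

lemma coord_tmul: "coord b (tmul w) = coord b w"
proof -
  obtain l i j where w: "w = (l, i, j)" by (metis surj_pair)
  show ?thesis
  proof (cases "l \<noteq> [] \<and> \<not> snd (hd l) \<and> i = 0")
    case True
    then obtain c m where "l = (c, False) # m" "i = 0" by (cases l) auto
    then show ?thesis by (cases m) (auto simp: w)
  next
    case False
    then show ?thesis by (cases l) (auto simp: w)
  qed
qed

lemma lead_Cons:
  "lead c (a # l) = lead c l + (if a = c \<and> l = replicate (length l) c then 1 else 0)"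
proof -
  have "l = replicate (length l) c \<longleftrightarrow> (\<forall>x\<in>set l. c = x)"
    by (metis in_set_replicate replicate_eqI)
  moreover have "takeWhile ((=) c) (rev l @ [a]) = rev l @ takeWhile ((=) c) [a] \<and>
      length (takeWhile ((=) c) (rev l)) = length l" if "\<forall>x\<in>set l. c = x"
  proof -
    have "length (takeWhile ((=) c) (rev l)) = length l"
      using that by (subst takeWhile_eq_all_conv[THEN iffD2]) auto
    then show ?thesis using that takeWhile_append2[of "rev l" "(=) c" "[a]"] by simp
  qed
  moreover have "takeWhile ((=) c) (rev l @ [a]) = takeWhile ((=) c) (rev l)" 
    if "\<not> (\<forall>x\<in>set l. c = x)"
  proof -
    obtain x where "x \<in> set (rev l)" "c \<noteq> x" using \<open>\<not> _\<close> by auto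
    then show ?thesis by (rule takeWhile_append1)
  qed
  ultimately show ?thesis by (cases "\<forall>x\<in>set l. c = x") (simp_all add: lead_def)
qed

lemma lead_replicate: "lead c (replicate n d) = (if c = d then n else 0)"
proof -
  have "lead c [] = 0" by (simp add: lead_def)
  then show ?thesis by (induction n) (auto simp: lead_Cons)
qed

lemma axis_run: "axis (run k) = k"
  by (cases "k \<ge> 0") (simp_all add: axis_def run_def lead_replicate)

lemma run_nonneg: "run (int n) = replicate n (0, True)"
  by (simp add: run_def)

lemma run_nonpos: "run (- int n) = replicate n (0, False)"
  by (simp add: run_def)

text \<open>Moving up along the axis is only possible across one of its edges, that is, at a normal form
  describing \<open>t\<^sup>k x\<^sup>j\<close>.\<close>

lemma axis_tmul:
  "axis (fst (tmul w)) = axis (fst w) \<or>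
   axis (fst (tmul w)) = axis (fst w) + 1 \<and> (\<exists>j. tmul w = (run (axis (fst w) + 1), j, 0))"
proof -
  obtain l i j where w: "w = (l, i, j)" by (metis surj_pair)
  show ?thesis
  proof (cases "l \<noteq> [] \<and> \<not> snd (hd l) \<and> i = 0")
    case True
    then obtain c m where l: "l = (c, False) # m" "i = 0" by (cases l) auto
    show ?thesis
    proof (cases "c = 0 \<and> m = replicate (length m) (0, False)")
      case True
      then obtain n where m: "m = replicate n (0, False)" by blast
      have "axis l = - int (Suc n)"
        using True unfolding l m by (simp add: axis_def lead_Cons lead_replicate)
      moreover have "tmul w = (run (- int n), j, 0)"
        using True l m by (simp add: w run_nonpos)
      ultimately show ?thesis by (simp add: w axis_run)
    next
      case False
      then have "axis m = axis l" using l by (auto simp: axis_def lead_Cons)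
      then show ?thesis using l by (simp add: w)
    qed
  next
    case False
    then have tw: "tmul w = ((i, True) # l, j, 0)" by (auto simp: w)
    show ?thesis
    proof (cases "i = 0 \<and> l = replicate (length l) (0, True)")
      case True
      then obtain n where m: "l = replicate n (0, True)" by blast
      have "axis l = int n" unfolding m by (simp add: axis_def lead_replicate)
      moreover have "tmul w = (run (int (Suc n)), j, 0)"
        using True tw m unfolding run_nonneg by simp
      ultimately show ?thesis by (simp add: w axis_run add.commute)
    next
      case False
      then have "axis ((i, True) # l) = axis l" by (auto simp: axis_def lead_Cons)
      then show ?thesis using tw by (simp add: w)
    qed
  qed
qed

lemma reduced_run: "reduced (run k)"
proof -
  have "reduced (replicate n a)" for n and a :: "int \<times> bool"
    by (induction n) (auto simp: reduced_Cons)
  then show ?thesis by (cases "k \<ge> 0") (simp_all add: run_def)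
qed

lemma tmul_run: "tmul (run k, 0, j) = (run (k + 1), j, 0)"
proof (cases "k \<ge> 0")
  case True
  then obtain n where "k = int n" by (metis nonneg_int_cases)
  moreover have "run (int n + 1) = replicate (Suc n) (0, True)" by (metis run_nonneg of_nat_Suc add.commute)
  ultimately show ?thesis by (auto simp: run_nonneg hd_replicate)
next
  case False
  then have "k = - int (Suc (nat (- k - 1)))" by simp
  then obtain n where n: "k = - int (Suc n)" by blast
  moreover have "run k = replicate (Suc n) (0, False)" unfolding n by (rule run_nonpos)
  moreover have "run (k + 1) = replicate n (0, False)" unfolding n using run_nonpos[of n] by simp
  ultimately show ?thesis by simp
qed

lemma run_1: "run 1 = [(0, True)]"
  by (simp add: run_def)

lemma line_closed: "el (run k, i, j) \<in> carrier hnn"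
  by (rule el_closed) (simp add: states_def reduced_run)

lemma v_closed: "v i j \<in> carrier hnn"
  by (rule el_closed) (simp add: states_def)

lemma t_closed: "t \<in> carrier hnn"
  by (rule el_closed) (simp add: states_def)

lemma t_pow: "t [^]\<^bsub>hnn\<^esub> (k::int) = el (run k, 0, 0)"
proof (induction k rule: int_induct[of _ 0])
  case base
  then show ?case by (simp add: hnn_one run_def)
next
  case (step1 k)
  have "t [^]\<^bsub>hnn\<^esub> (k + 1) = t [^]\<^bsub>hnn\<^esub> k \<otimes>\<^bsub>hnn\<^esub> t"
    using t_closed by (simp add: hnn.int_pow_mult hnn.int_pow_1)
  then show ?case using step1 by (simp add: mult_t tmul_run del: tmul.simps)
next
  case (step2 k)
  have "t [^]\<^bsub>hnn\<^esub> (k - 1) \<otimes>\<^bsub>hnn\<^esub> t = t [^]\<^bsub>hnn\<^esub> k"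
    using t_closed hnn.int_pow_mult[of t "k - 1" 1] by (simp add: hnn.int_pow_1)
  also have "\<dots> = el (run (k - 1), 0, 0) \<otimes>\<^bsub>hnn\<^esub> t"
    using step2 by (simp add: mult_t tmul_run del: tmul.simps)
  finally show ?case
    using t_closed line_closed by (simp add: hnn.int_pow_closed)
qed

lemma line_eq: "el (run k, j, 0) = t [^]\<^bsub>hnn\<^esub> k \<otimes>\<^bsub>hnn\<^esub> v j 0"
  by (simp add: t_pow mult_v)

lemma line_Suc_eq: "el (run (k + 1), j, 0) = t [^]\<^bsub>hnn\<^esub> k \<otimes>\<^bsub>hnn\<^esub> el (run 1, j, 0)"
  using t_closed by (simp add: line_eq hnn.int_pow_mult hnn.m_assoc v_closed hnn.int_pow_1)

text \<open>Every generator is x^p y^q or x^p y^q t, so an invariant need only be checked for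
  \<open>shift\<close> and \<open>tmul\<close>. The bound on the total is restricted to
  \<open>gens\<close> because x^3 violates it.\<close>

lemma gens'_step:
  assumes "s \<in> gens'"
  obtains p q where "\<bar>p\<bar> + \<bar>q\<bar> \<le> 3" "s \<in> gens \<Longrightarrow> \<bar>p + q\<bar> \<le> 1"
    "(\<forall>w. el w \<otimes>\<^bsub>hnn\<^esub> s = el (shift p q w)) \<or> (\<forall>w. el w \<otimes>\<^bsub>hnn\<^esub> s = el (tmul (shift p q w)))"
proof -
  consider "s = t" | "s = v 1 0" | "s = v 2 (-1)" | "s = el ([(-2, True)], 1, 0)"
    | "s = v 3 0" "s \<notin> gens"
    using assms by (auto simp: gens'_def gens_def)
  then show ?thesis
  proof cases
    case 1
    then show ?thesis by (intro that[of 0 0]) (auto simp: mult_t shift_0 simp del: tmul.simps)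
  next
    case 2
    then show ?thesis by (intro that[of 1 0]) (auto simp: mult_v simp del: shift.simps)
  next
    case 3
    then show ?thesis by (intro that[of 2 "-1"]) (auto simp: mult_v simp del: shift.simps)
  next
    case 4
    then show ?thesis
      by (intro that[of "-2" 1]) (auto simp: mult_vt simp del: tmul.simps shift.simps)
  next
    case 5
    then show ?thesis by (intro that[of 3 0]) (auto simp: mult_v simp del: shift.simps)
  qed
qed

lemma state_cases:
  assumes "g \<in> carrier hnn"
  obtains w where "w \<in> states" "g = el w"
  using assms by (auto simp: hnn_carrier)

lemma xsum_step:
  assumes "g \<in> carrier hnn" "s \<in> gens"
  shows "\<bar>xsum (st (g \<otimes>\<^bsub>hnn\<^esub> s)) - xsum (st g)\<bar> \<le> 1"
proof -
  have "s \<in> gens'" using assms by (simp add: gens'_def)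
  then show ?thesis
    by (rule gens'_step) (rule state_cases[OF assms(1)],
        use assms(2) in \<open>auto simp: xsum_shift xsum_tmul simp del: tmul.simps shift.simps xsum.simps\<close>)
qed

lemma tsum_step:
  assumes "g \<in> carrier hnn" "s \<in> gens'"
  shows "\<bar>tsum (st (g \<otimes>\<^bsub>hnn\<^esub> s)) - tsum (st g)\<bar> \<le> 1"
  using assms(2)
  by (rule gens'_step) (rule state_cases[OF assms(1)],
      auto simp: tsum_shift tsum_tmul simp del: tmul.simps shift.simps tsum.simps)

lemma coord_step:
  assumes "g \<in> carrier hnn" "s \<in> gens'"
  shows "\<bar>coord b (st (g \<otimes>\<^bsub>hnn\<^esub> s)) - coord b (st g)\<bar> \<le> 3"
proof -
  obtain p q where pq: "\<bar>p\<bar> + \<bar>q\<bar> \<le> 3"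
    "(\<forall>w. el w \<otimes>\<^bsub>hnn\<^esub> s = el (shift p q w)) \<or> (\<forall>w. el w \<otimes>\<^bsub>hnn\<^esub> s = el (tmul (shift p q w)))"
    using gens'_step[OF assms(2)] by metis
  obtain w where w: "w \<in> states" "g = el w" using state_cases[OF assms(1)] .
  have "coord b (st (g \<otimes>\<^bsub>hnn\<^esub> s)) = coord b (shift p q w)"
    using pq(2) coord_tmul[of b "shift p q w"] w(2) by (metis st_el)
  then show ?thesis using coord_shift[of b p q w] pq(1) w(2) by simp
qed

lemma axis_step:
  assumes "g \<in> carrier hnn" "s \<in> gens'"
  defines "k \<equiv> axis (fst (st g))"
  shows "axis (fst (st (g \<otimes>\<^bsub>hnn\<^esub> s))) = k \<or>
     axis (fst (st (g \<otimes>\<^bsub>hnn\<^esub> s))) = k + 1 \<and> (\<exists>j. g \<otimes>\<^bsub>hnn\<^esub> s = el (run (k + 1), j, 0))"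
proof -
  obtain p q where pq:
    "(\<forall>w. el w \<otimes>\<^bsub>hnn\<^esub> s = el (shift p q w)) \<or> (\<forall>w. el w \<otimes>\<^bsub>hnn\<^esub> s = el (tmul (shift p q w)))"
    using gens'_step[OF assms(2)] by metis
  obtain w where w: "w \<in> states" "g = el w" using state_cases[OF assms(1)] .
  have "fst (shift p q w) = fst w" by (cases w) simp
  then show ?thesis
    using pq axis_tmul[of "shift p q w"] w(2) unfolding k_def by (metis st_el)
qed

section \<open>The axis of the stable letter\<close>

abbreviation d' :: "nat \<Rightarrow> nat \<Rightarrow> nat" where "d' \<equiv> word_dist hnn gens'"

abbreviation line :: "int \<Rightarrow> int \<Rightarrow> nat" where "line k j \<equiv> el (run k, j, 0)"

lemma tsum_run: "tsum (run k, i, j) = k"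
  by (cases "k \<ge> 0") (simp_all add: run_def sum_list_replicate)

lemma sum_list_run: "sum_list (map fst (run k)) = 0"
  by (simp add: run_def sum_list_replicate)

text \<open>The exponent sum of t bounds the distance from below, the obvious word in t from above.
  A general \<open>S\<close> serves both generating sets.\<close>

lemma t_pow_dist:
  assumes "marked_group hnn S" "t \<in> S" "S \<subseteq> gens'"
  shows "word_dist hnn S (t [^]\<^bsub>hnn\<^esub> (m::int)) (t [^]\<^bsub>hnn\<^esub> (n::int)) = nat \<bar>m - n\<bar>"
proof -
  interpret S: marked_group hnn S by fact
  have "\<bar>tsum (st (t [^]\<^bsub>hnn\<^esub> n)) - tsum (st (t [^]\<^bsub>hnn\<^esub> m))\<bar>
      \<le> 1 * int (S.wd (t [^]\<^bsub>hnn\<^esub> m) (t [^]\<^bsub>hnn\<^esub> n))"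
    by (rule S.lipschitz_le_wd[where F = "\<lambda>g. tsum (st g)"])
      (use assms tsum_step t_closed in auto)
  then have ge: "\<bar>n - m\<bar> \<le> int (S.wd (t [^]\<^bsub>hnn\<^esub> m) (t [^]\<^bsub>hnn\<^esub> n))"
    by (simp add: t_pow tsum_run del: tsum.simps)
  have up: "S.wd (t [^]\<^bsub>hnn\<^esub> m) (t [^]\<^bsub>hnn\<^esub> (m + int k)) \<le> k" for m k
  proof (induction k)
    case 0
    then show ?case using S.wd_refl t_closed by simp
  next
    case (Suc k)
    have "t [^]\<^bsub>hnn\<^esub> (m + int (Suc k)) = t [^]\<^bsub>hnn\<^esub> (m + int k) \<otimes>\<^bsub>hnn\<^esub> t"
      using t_closed hnn.int_pow_mult[of t "m + int k" 1]
      by (simp add: hnn.int_pow_1 ac_simps)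
    then have "S.wd (t [^]\<^bsub>hnn\<^esub> (m + int k)) (t [^]\<^bsub>hnn\<^esub> (m + int (Suc k))) \<le> 1"
      using S.wd_letter[of "t [^]\<^bsub>hnn\<^esub> (m + int k)" t] assms(2) t_closed by simp
    then show ?case
      using Suc S.wd_triangle[of "t [^]\<^bsub>hnn\<^esub> m" "t [^]\<^bsub>hnn\<^esub> (m + int k)" "t [^]\<^bsub>hnn\<^esub> (m + int (Suc k))"]
        t_closed by simp
  qed
  show ?thesis
  proof (cases "m \<le> n")
    case True
    then show ?thesis using up[of m "nat (n - m)"] ge by simp
  next
    case False
    then have "S.wd (t [^]\<^bsub>hnn\<^esub> n) (t [^]\<^bsub>hnn\<^esub> m) \<le> nat (m - n)"
      using up[of n "nat (m - n)"] by simp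
    then show ?thesis
      using False ge S.wd_commute[of "t [^]\<^bsub>hnn\<^esub> m" "t [^]\<^bsub>hnn\<^esub> n"] t_closed by simp
  qed
qed

lemma is_geodesic_t_line:
  assumes "marked_group hnn S" "t \<in> S" "S \<subseteq> gens'"
  shows "is_geodesic (cay_dist hnn S) (cay_line hnn t)"
proof -
  interpret S: marked_group hnn S by fact
  show ?thesis using assms(2) t_pow_dist[OF assms] by (rule S.is_geodesic_cay_line)
qed

section \<open>Contraction for the larger generating set\<close>

lemma line_crossing:
  assumes g: "g \<in> carrier hnn" and h: "h \<in> carrier hnn"
    and k: "axis (fst (st g)) < k" "k \<le> axis (fst (st h))"
  shows "\<exists>j. d' g (line k j) + d' (line k j) h \<le> d' g h"
proof -
  obtain f s where f: "f \<in> carrier hnn" "s \<in> gens' \<union> m_inv hnn ` gens'"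
      "\<not> k \<le> axis (fst (st f))" "k \<le> axis (fst (st (f \<otimes>\<^bsub>hnn\<^esub> s)))"
      "d' g (f \<otimes>\<^bsub>hnn\<^esub> s) + d' (f \<otimes>\<^bsub>hnn\<^esub> s) h \<le> d' g h"
    using X'.wd_crossing[OF g h, of "\<lambda>g. k \<le> axis (fst (st g))"] k by auto
  \<comment> \<open>By \<open>axis_step\<close> a generator never lowers the index, so an inverse
    letter never raises it; the crossing is made by a generator.\<close>
  have "s \<in> gens'"
  proof (rule ccontr)
    assume "s \<notin> gens'"
    then obtain r where r: "r \<in> gens'" "s = inv\<^bsub>hnn\<^esub> r" using f(2) by blast
    then have "f \<otimes>\<^bsub>hnn\<^esub> s \<in> carrier hnn" "(f \<otimes>\<^bsub>hnn\<^esub> s) \<otimes>\<^bsub>hnn\<^esub> r = f"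
      using f(1) gens'_carrier by (auto simp: hnn.m_assoc subset_iff)
    then show False using axis_step[OF _ r(1), of "f \<otimes>\<^bsub>hnn\<^esub> s"] f(3,4) by auto
  qed
  then obtain j where "f \<otimes>\<^bsub>hnn\<^esub> s = line k j"
    using axis_step[of f s] f by (smt (verit))
  then show ?thesis using f(5) by auto
qed

text \<open>After translation by t^-k the points are x^i and t x^j = y^j t. Their x-coordinates in
  the flat are i and 0, their y-coordinates 0 and j, and \<open>coord\<close> is
  3-Lipschitz.\<close>

lemma line_Suc_dist:
  "\<bar>i\<bar> \<le> 3 * int (d' (line k i) (line (k + 1) j))"
  "\<bar>j\<bar> \<le> 3 * int (d' (line k i) (line (k + 1) j))"
proof -
  have "d' (line k i) (line (k + 1) j) = d' (v i 0) (line 1 j)"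
    unfolding line_Suc_eq line_eq[of k] using t_closed v_closed line_closed
    by (intro X'.wd_left_mult) auto
  moreover have "\<bar>coord b (st (line 1 j)) - coord b (st (v i 0))\<bar> \<le> 3 * int (d' (v i 0) (line 1 j))" for b
    by (rule X'.lipschitz_le_wd[where F = "\<lambda>g. coord b (st g)"])
      (use coord_step v_closed line_closed in auto)
  from this[of True] this[of False]
  have "\<bar>i\<bar> \<le> 3 * int (d' (v i 0) (line 1 j))" "\<bar>j\<bar> \<le> 3 * int (d' (v i 0) (line 1 j))"
    by (simp_all add: run_1)
  ultimately show "\<bar>i\<bar> \<le> 3 * int (d' (line k i) (line (k + 1) j))"
    "\<bar>j\<bar> \<le> 3 * int (d' (line k i) (line (k + 1) j))" by simp_all
qed

lemma line_dist_ge: "\<bar>k - m\<bar> \<le> int (d' (line k i) (line m j))"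
proof -
  have "\<bar>tsum (st (line m j)) - tsum (st (line k i))\<bar> \<le> 1 * int (d' (line k i) (line m j))"
    by (rule X'.lipschitz_le_wd[where F = "\<lambda>g. tsum (st g)"])
      (use tsum_step line_closed in auto)
  then show ?thesis by (simp add: tsum_run del: tsum.simps)
qed

text \<open>Walk with x^3 and use x for the remainder. The worst remainder is 2, where two steps
  give 6 = 2 + 4.\<close>

lemma line_dist_axis: "3 * int (d' (line k j) (t [^]\<^bsub>hnn\<^esub> k)) \<le> \<bar>j\<bar> + 4"
proof -
  have step: "d' (line k i) (line k (i + e)) \<le> 1" if "v e 0 \<in> gens'" for i e k
    using X'.wd_letter[OF line_closed[of k i 0], of "v e 0"] that by (simp add: mult_v)
  have up: "3 * d' (line k i) (line k (i + int n)) \<le> n + 4" for n i k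
  proof (induction n arbitrary: i rule: less_induct)
    case (less n)
    have tri: "d' (line k i) (line k (i + e + f)) \<le> 1 + d' (line k (i + e)) (line k (i + e + f))"
      if "v e 0 \<in> gens'" for i e f
      using step[OF that, of k i] X'.wd_triangle[OF line_closed[of k i 0] line_closed line_closed]
      by (meson add_le_mono1 le_trans)
    have one: "v 1 0 \<in> gens'" and three: "v 3 0 \<in> gens'" by (auto simp: gens'_def gens_def)
    consider "n = 0" | "n = 1" | "n = 2" | "n \<ge> 3" by linarith
    then show ?case
    proof cases
      case 1
      then show ?thesis using X'.wd_refl line_closed by simp
    next
      case 2
      then show ?thesis using step[OF one, of k i] by simp
    next
      case 3
      then show ?thesis using tri[OF one, of i 1] step[OF one, of k "i + 1"] by (simp add: add.assoc)
    next
      case 4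
      then have "i + int n = i + 3 + int (n - 3)" by simp
      then show ?thesis
        using tri[OF three, of i "int (n - 3)"] less[of "n - 3" "i + 3"] 4 by simp
    qed
  qed
  show ?thesis
  proof (cases "j \<ge> 0")
    case True
    then show ?thesis
      using up[of k 0 "nat j"] X'.wd_commute[OF line_closed line_closed, of k j 0 k 0 0]
      by (simp add: t_pow)
  next
    case False
    then show ?thesis using up[of k j "nat (- j)"] by (simp add: t_pow)
  qed
qed

text \<open>Otherwise a geodesic from \<open>g\<close> to \<open>h\<close> meets some t^k x^j, then
  pays |j|/3 for the adjacent crossing and at least 4 for four more indices. Turning to t^k instead
  costs at most (|j| + 4)/3, so t^k would be nearer to \<open>g\<close> than \<open>h\<close>
  is.\<close>

lemma nearest_axis:
  assumes g: "g \<in> carrier hnn" and h: "h \<in> carrier hnn"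
    and near: "\<And>n::int. d' g h \<le> d' g (t [^]\<^bsub>hnn\<^esub> n)"
  shows "\<bar>axis (fst (st g)) - axis (fst (st h))\<bar> \<le> 5"
proof (rule ccontr)
  let ?a = "\<lambda>g. axis (fst (st g))"
  have to_axis: "3 * int (d' g (t [^]\<^bsub>hnn\<^esub> k)) \<le> 3 * int (d' g (line k j)) + \<bar>j\<bar> + 4" for k j
    using X'.wd_triangle[OF g line_closed[of k j 0] line_closed[of k 0 0]] line_dist_axis[of k j]
    by (simp add: t_pow)
  assume "\<not> \<bar>?a g - ?a h\<bar> \<le> 5"
  then consider "?a g + 6 \<le> ?a h" | "?a h + 6 \<le> ?a g" by linarith
  then show False
  proof cases
    case 1
    define k where "k = ?a g + 1"
    obtain j where j: "d' g (line k j) + d' (line k j) h \<le> d' g h"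
      using line_crossing[OF g h, of k] 1 by (auto simp: k_def)
    obtain j' where j': "d' (line k j) (line (k + 1) j') + d' (line (k + 1) j') h \<le> d' (line k j) h"
      using line_crossing[OF line_closed[of k j 0] h, of "k + 1"] 1 by (auto simp: k_def axis_run)
    obtain j'' where j'': "d' (line (k + 1) j') (line (k + 5) j'') + d' (line (k + 5) j'') h
        \<le> d' (line (k + 1) j') h"
      using line_crossing[OF line_closed[of "k + 1" j' 0] h, of "k + 5"] 1 by (auto simp: k_def axis_run)
    show False
      using j j' j'' line_Suc_dist(1)[of j k j'] line_dist_ge[of "k + 1" "k + 5" j' j'']
        to_axis[of k j] near[of k] by linarith
  next
    case 2
    \<comment> \<open>\<open>line_crossing\<close> needs increasing indices, so the geodesic is read
      from \<open>h\<close>. Seen from \<open>g\<close>, the strip between two lines is entered at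
      its upper end, whence the second bound of \<open>line_Suc_dist\<close>.\<close>
    define k where "k = ?a h + 6"
    obtain j where j: "d' h (line k j) + d' (line k j) g \<le> d' h g"
      using line_crossing[OF h g, of k] 2 by (auto simp: k_def)
    obtain j' where j': "d' h (line (k - 1) j') + d' (line (k - 1) j') (line k j) \<le> d' h (line k j)"
      using line_crossing[OF h line_closed[of k j 0], of "k - 1"] by (auto simp: k_def axis_run)
    obtain j'' where j'': "d' h (line (k - 5) j'') + d' (line (k - 5) j'') (line (k - 1) j')
        \<le> d' h (line (k - 1) j')"
      using line_crossing[OF h line_closed[of "k - 1" j' 0], of "k - 5"] by (auto simp: k_def axis_run)
    show False
      using j j' j'' line_Suc_dist(2)[of j "k - 1" j'] line_dist_ge[of "k - 5" "k - 1" j'' j']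
        to_axis[of k j] near[of k] X'.wd_commute[OF g h]
        X'.wd_commute[OF g line_closed[of k j 0]] by simp
  qed
qed

lemma contracting_t_line:
  "strongly_contracting (cay_points hnn gens') (cay_dist hnn gens') (range (cay_line hnn t))"
proof (rule X'.strongly_contracting_cay_line[where \<pi> = "\<lambda>g. axis (fst (st g))"])
  show "t \<in> gens'" by (simp add: gens'_def gens_def)
  then show "is_geodesic (cay_dist hnn gens') (cay_line hnn t)"
    by (intro is_geodesic_t_line X'.marked_group_axioms) auto
  show "axis (fst (st (t [^]\<^bsub>hnn\<^esub> n))) = n" for n :: int
    by (simp add: t_pow axis_run)
  show "\<bar>axis (fst (st (g \<otimes>\<^bsub>hnn\<^esub> s))) - axis (fst (st g))\<bar> \<le> 1"
    if "g \<in> carrier hnn" "s \<in> gens'" for g s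
    using axis_step[OF that] by auto
qed (rule nearest_axis)

section \<open>Failure of contraction for the smaller generating set\<close>

lemma line_halving: "word_dist hnn gens (line k (2 * int (Suc n))) (line (k + 1) (int (Suc n))) \<le> Suc n"
proof -
  have w: "word_dist hnn gens (el (run k, i, int m)) (el (run k, i - 2 * int n, int m + int n)) \<le> n" for n m i
  proof (induction n)
    case 0
    then show ?case using X.wd_refl line_closed by simp
  next
    case (Suc n)
    have "el (run k, i - 2 * int (Suc n), int m + int (Suc n)) \<otimes>\<^bsub>hnn\<^esub> v 2 (-1)
        = el (run k, i - 2 * int n, int m + int n)" by (simp add: mult_v)
    then have "word_dist hnn gens (el (run k, i - 2 * int (Suc n), int m + int (Suc n)))
        (el (run k, i - 2 * int n, int m + int n)) \<le> 1"
      using X.wd_letter[OF line_closed[of k "i - 2 * int (Suc n)" "int m + int (Suc n)"], of "v 2 (-1)"]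
      by (simp add: gens_def)
    then show ?case
      using Suc X.wd_triangle[OF line_closed line_closed line_closed, of k i "int m"
          k "i - 2 * int (Suc n)" "int m + int (Suc n)" k "i - 2 * int n" "int m + int n"]
        X.wd_commute[OF line_closed line_closed, of k "i - 2 * int n" "int m + int n"
          k "i - 2 * int (Suc n)" "int m + int (Suc n)"]
      by linarith
  qed
  \<comment> \<open>The last s^-1 and t form a single letter: x^2 y^n s^-1 t = y^(n+1) t = t
    x^(n+1). This keeps the count at \<open>Suc n\<close>.\<close>
  have "el (run k, 2, int n) \<otimes>\<^bsub>hnn\<^esub> el ([(-2, True)], 1, 0) = line (k + 1) (int (Suc n))"
    by (simp add: mult_vt tmul_run add.commute del: tmul.simps)
  then have "word_dist hnn gens (el (run k, 2, int n)) (line (k + 1) (int (Suc n))) \<le> 1"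
    using X.wd_letter[OF line_closed[of k 2 "int n"], of "el ([(-2, True)], 1, 0)"] by (simp add: gens_def)
  then show ?thesis
    using w[of "2 * int (Suc n)" 0 n]
      X.wd_triangle[OF line_closed line_closed line_closed, of k "2 * int (Suc n)" 0
        "k + 1" "int (Suc n)" 0 k 2 "int n"]
    by simp
qed

text \<open>The halvings cost 2^(n-1) + ... + 1 and the remaining x costs 1; the sum 2^n equals the
  length of the direct way in \<open>line_dist_1\<close>.\<close>

lemma line_dist_pow_2: "word_dist hnn gens (line m (2 ^ n)) (t [^]\<^bsub>hnn\<^esub> (m + int n)) \<le> 2 ^ n"
proof (induction n arbitrary: m)
  case 0
  have "line m 0 \<otimes>\<^bsub>hnn\<^esub> v 1 0 = line m 1" by (simp add: mult_v)
  then have "word_dist hnn gens (line m 0) (line m 1) \<le> 1"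
    using X.wd_letter[OF line_closed[of m 0 0], of "v 1 0"] by (simp add: gens_def)
  then show ?case using X.wd_commute[OF line_closed line_closed, of m 0 0 m 1 0] by (simp add: t_pow)
next
  case (Suc n)
  have "\<exists>r. (2::nat) ^ n = Suc r" by (metis not0_implies_Suc power_eq_0_iff zero_neq_numeral)
  then obtain r where r: "(2::nat) ^ n = Suc r" by blast
  then have "int (Suc r) = 2 ^ n" by (metis of_nat_numeral of_nat_power)
  then have "word_dist hnn gens (line m (2 ^ Suc n)) (line (m + 1) (2 ^ n)) \<le> 2 ^ n"
    using line_halving[of m r] r by simp
  moreover have "word_dist hnn gens (line (m + 1) (2 ^ n)) (t [^]\<^bsub>hnn\<^esub> (m + int (Suc n))) \<le> 2 ^ n"
    using Suc[of "m + 1"] by (simp add: add.assoc)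
  ultimately show ?case
    using X.wd_triangle[OF line_closed line_closed, of "t [^]\<^bsub>hnn\<^esub> (m + int (Suc n))" m "2 ^ Suc n" 0 "m + 1" "2 ^ n" 0]
      t_closed by simp
qed

lemma line_dist_1: "word_dist hnn gens (line m (int n)) (t [^]\<^bsub>hnn\<^esub> m) \<le> n"
proof (induction n)
  case 0
  then show ?case using X.wd_refl line_closed by (simp add: t_pow)
next
  case (Suc n)
  have "line m (int n) \<otimes>\<^bsub>hnn\<^esub> v 1 0 = line m (int (Suc n))" by (simp add: mult_v add.commute)
  then have "word_dist hnn gens (line m (int n)) (line m (int (Suc n))) \<le> 1"
    using X.wd_letter[OF line_closed[of m "int n" 0], of "v 1 0"] by (simp add: gens_def)
  then show ?case
    using Suc X.wd_triangle[OF line_closed[of m "int (Suc n)" 0] line_closed[of m "int n" 0] line_closed[of m 0 0]]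
      X.wd_commute[OF line_closed line_closed, of m "int n" 0 m "int (Suc n)" 0]
    by (simp add: t_pow)
qed

lemma not_contracting_t_line:
  "\<not> strongly_contracting (cay_points hnn gens) (cay_dist hnn gens) (range (cay_line hnn t))"
proof
  let ?d = "cay_dist hnn gens" and ?L = "cay_line hnn t"
  assume "strongly_contracting (cay_points hnn gens) ?d (range ?L)"
  then obtain C where C: "\<And>x x' y y'. \<lbrakk>x \<in> cay_points hnn gens; x' \<in> cay_points hnn gens;
      ?d x x' \<le> (INF z\<in>range ?L. ?d x z); y \<in> cproj ?d (range ?L) x \<union> cproj ?d (range ?L) x';
      y' \<in> cproj ?d (range ?L) x \<union> cproj ?d (range ?L) x'\<rbrakk> \<Longrightarrow> ?d y y' \<le> C"
    unfolding strongly_contracting_def by metis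
  have t: "t \<in> gens" by (simp add: gens_def)
  obtain n :: nat where n: "C < real n" using reals_Archimedean2 by blast
  define p where "p = (line 0 (2 ^ n), t, 0 :: real)"
  have p: "p \<in> cay_points hnn gens" using t line_closed by (simp add: p_def cay_points_def)
  \<comment> \<open>The total exponent is 2^n at both ends of the edge of \<open>p\<close> and 0 at
    both ends of every edge of the line. This excludes a common edge and bounds every other path
    from below.\<close>
  have ge: "2 ^ n \<le> ?d p (?L z)" for z
  proof (cases rule: X.cay_dist_cases[of p "?L z"])
    case 1
    then have "line 0 (2 ^ n) = line \<lfloor>z\<rfloor> 0" by (simp add: p_def cay_line_def t_pow)
    then have "xsum (st (line 0 (2 ^ n))) = xsum (st (line \<lfloor>z\<rfloor> 0))" by simp
    then show ?thesis by (simp add: sum_list_run)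
  next
    case (2 g a h b)
    have g: "g \<in> carrier hnn" and h: "h \<in> carrier hnn" and ab: "0 \<le> a" "0 \<le> b"
      using 2 p X.ends_carrier X.ends_nonneg X.cay_line_points[OF t] by blast+
    have "xsum (st g) = 2 ^ n"
      using 2(1) by (auto simp: p_def X.ends_def mult_t xsum_tmul sum_list_run simp del: tmul.simps)
    moreover have "xsum (st h) = 0"
      using 2(2) by (auto simp: cay_line_def X.ends_def t_pow mult_t xsum_tmul sum_list_run simp del: tmul.simps)
    moreover have "\<bar>xsum (st h) - xsum (st g)\<bar> \<le> 1 * int (word_dist hnn gens g h)"
      by (rule X.lipschitz_le_wd[where F = "\<lambda>g. xsum (st g)"]) (use xsum_step g h in auto)
    ultimately have "(2::int) ^ n \<le> int (word_dist hnn gens g h)" by simp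
    then have "(2::real) ^ n \<le> real (word_dist hnn gens g h)"
      by (metis of_int_le_iff of_int_numeral of_int_of_nat_eq of_int_power)
    then show ?thesis using 2(3) ab by linarith
  qed
  have le: "?d p (?L (real m)) \<le> 2 ^ n" if "m = 0 \<or> m = n" for m
  proof -
    have "word_dist hnn gens (line 0 (2 ^ n)) (t [^]\<^bsub>hnn\<^esub> int m) \<le> 2 ^ n"
      using that line_dist_pow_2[of 0 n] line_dist_1[of 0 "2 ^ n"] by auto
    then have "real (word_dist hnn gens (line 0 (2 ^ n)) (t [^]\<^bsub>hnn\<^esub> int m)) \<le> 2 ^ n"
      by (metis of_nat_le_iff of_nat_numeral of_nat_power)
    moreover have "?d p (?L (real m)) \<le> 0 + real (word_dist hnn gens (line 0 (2 ^ n)) (t [^]\<^bsub>hnn\<^esub> int m)) + 0"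
      by (rule X.cay_dist_le_ends) (auto simp: X.ends_def p_def cay_line_def)
    ultimately show ?thesis by linarith
  qed
  have "(INF z\<in>range ?L. ?d p z) \<ge> 2 ^ n"
    by (rule cINF_greatest) (use ge in auto)
  then have inf: "(INF z\<in>range ?L. ?d p z) = 2 ^ n"
    using X.INF_cay_line_le[OF t p, of "real 0"] le[of 0] by simp
  then have proj: "?L (real m) \<in> cproj ?d (range ?L) p" if "m = 0 \<or> m = n" for m
    using le[OF that] ge[of "real m"] by (simp add: cproj_def)
  \<comment> \<open>Both points in the definition of contraction are taken to be \<open>p\<close>:
    its projection alone contains 1 and t^n, at distance n > C.\<close>
  have "?d p p \<le> (INF z\<in>range ?L. ?d p z)"
  proof -
    have "?d p p \<le> 0 + real (word_dist hnn gens (fst p) (fst p)) + 0"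
      by (rule X.cay_dist_le_ends) (auto simp: X.ends_def p_def)
    then have "?d p p \<le> 0" using X.wd_refl line_closed by (simp add: p_def)
    also have "\<dots> \<le> 2 ^ n" by simp
    finally show ?thesis using inf by simp
  qed
  then have "?d (?L (real 0)) (?L (real n)) \<le> C"
    using C[OF p p] proj by blast
  moreover have "is_geodesic ?d ?L"
    using t by (intro is_geodesic_t_line X.marked_group_axioms) (auto simp: gens'_def)
  ultimately show False using n by (simp add: is_geodesic_def)
qed

theorem theorem4:
  shows "\<exists>(G :: nat monoid) S S' a.
    group G \<and> finite S' \<and> S \<subseteq> S' \<and> S' \<subseteq> carrier G \<and>
    generate G S = carrier G \<and> generate G S' = carrier G \<and> a \<in> S \<and>
    is_geodesic (cay_dist G S) (cay_line G a) \<and>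
    \<not> strongly_contracting (cay_points G S) (cay_dist G S) (range (cay_line G a)) \<and>
    is_geodesic (cay_dist G S') (cay_line G a) \<and>
    strongly_contracting (cay_points G S') (cay_dist G S') (range (cay_line G a))"
proof (intro exI conjI)
  show "group hnn" by (rule group_hnn)
  show "finite gens'" "gens \<subseteq> gens'" "t \<in> gens" by (auto simp: gens'_def gens_def)
  then show "is_geodesic (cay_dist hnn gens) (cay_line hnn t)"
    "is_geodesic (cay_dist hnn gens') (cay_line hnn t)"
    using is_geodesic_t_line X.marked_group_axioms X'.marked_group_axioms by auto
qed (fact gens'_carrier generate_gens X'.S_generates not_contracting_t_line contracting_t_line)+

end
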